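(* Fix any $\rho>0$ (and $\beta\in(0,1)$). Let $\{(x_k,y_k)\}_{k\ge 1}$ be a sequence generated by the algorithm BALA (described in the context, run without an iteration limit) applied to the problem $\min\{\langle c,x\rangle:\mathcal{A}x=b,\ x\in\Omega\}$. Then 1. the sequence $\{y_k\}$ converges to an optimal solution of the dual problem $\min_{y\in\mathbb{R}^m} g(y)$; 2. $\lim_{k\to\infty}\|\mathcal{A}x_k-b\|=0$ and $\lim_{k\to\infty}\langle c,x_k\rangle-p^\star=0$.
   Context: Problem. $\Omega\subseteq\mathbb{R}^n$ is a compact convex set, $\mathcal{A}:\mathbb{R}^n\to\mathbb{R}^m$ is linear with adjoint $\mathcal{A}^*$, $b\in\mathbb{R}^m$, $c\in\mathbb{R}^n$. The primal problem is $p^\star=\min\{\langle c,x\rangle:\mathcal{A}x=b,\ x\in\Omega\}$. The Lagrangian is $\mathcal{L}(x,y)=\langle c,x\rangle+\langle y,b-\mathcal{A}x\rangle$ and, for $\rho>0$, the augmented Lagrangian is $\mathcal{L}_\rho(x,y)=\mathcal{L}(x,y)+\frac{\rho}{2}\|b-\mathcal{A}x\|^2$. Put $g(y)=-\min_{x\in\Omega}\mathcal{L}(x,y)$; the dual problem, written as a minimization, is $g^\star=\min_{y\in\mathbb{R}^m}g(y)$. Standing assumption: Slater's condition holds for the primal and the dual, so both are solvable and strong duality $p^\star=-g^\star$ holds. Algorithm BALA. Inputs: a nonempty closed convex set $\Omega_1\subseteq\Omega$, $x_1\in\mathbb{R}^n$, $y_1\in\mathbb{R}^m$, $\rho>0$,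 $\beta\in(0,1)$. For $k=1,2,\ldots$: (a) compute an exact solution $w_{k+1}\in\arg\min_{x\in\Omega_k}\mathcal{L}_\rho(x,y_k)$ and set $z_{k+1}=y_k+\rho(b-\mathcal{A}w_{k+1})$; (b) let $g_k(y)=-\min_{x\in\Omega_k}\mathcal{L}(x,y)$. If $g(y_k)-g(z_{k+1})\ge\beta\,(g(y_k)-g_k(z_{k+1}))$, set $x_{k+1}=w_{k+1}$, $y_{k+1}=z_{k+1}$ (descent step); otherwise set $x_{k+1}=x_k$, $y_{k+1}=y_k$ (null step); (c) choose any set $\Omega_{k+1}$ such that: $\Omega_{k+1}$ is convex and closed; $\Omega_{k+1}\subseteq\Omega$; $v_{k+1}\in\Omega_{k+1}$ for some $v_{k+1}\in\Omega$ with $g(z_{k+1})=-\mathcal{L}(v_{k+1},z_{k+1})$; and, if step $k$ is a null step, $w_{k+1}\in\Omega_{k+1}$.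
   Formalization: Part 2 is proved only for runs with infinitely many descent steps; as stated it is false, since if y_k is exactly dual optimal all later steps can be null, which freezes x_k at a possibly infeasible point. Part 1 is proved for every run. *)

theory Defs
  imports "HOL-Analysis.Analysis"
begin

definition lagr ::
  "(real ^ 'n \<Rightarrow> real ^ 'm) \<Rightarrow> real ^ 'm \<Rightarrow> real ^ 'n \<Rightarrow> real ^ 'n \<Rightarrow> real ^ 'm \<Rightarrow> real"
  where "lagr A b c x y = c \<bullet> x + y \<bullet> (b - A x)"

definition aug_lagr ::
  "(real ^ 'n \<Rightarrow> real ^ 'm) \<Rightarrow> real ^ 'm \<Rightarrow> real ^ 'n \<Rightarrow> real \<Rightarrow> real ^ 'n \<Rightarrow> real ^ 'm \<Rightarrow> real"
  where "aug_lagr A b c \<rho> x y = lagr A b c x y + \<rho> / 2 * (norm (b - A x))\<^sup>2"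

(* Minima are written as infima.  They are attained for nonempty compact S, which covers both g
   (S = \<Omega>) and the models g_k (S = \<Omega>_k, a closed subset of \<Omega>). *)
definition dual_fun ::
  "(real ^ 'n \<Rightarrow> real ^ 'm) \<Rightarrow> real ^ 'm \<Rightarrow> real ^ 'n \<Rightarrow> (real ^ 'n) set \<Rightarrow> real ^ 'm \<Rightarrow> real"
  where "dual_fun A b c S y = - (INF x\<in>S. lagr A b c x y)"

definition primal_opt_val ::
  "(real ^ 'n \<Rightarrow> real ^ 'm) \<Rightarrow> real ^ 'm \<Rightarrow> real ^ 'n \<Rightarrow> (real ^ 'n) set \<Rightarrow> real"
  where "primal_opt_val A b c \<Omega> = (INF x\<in>{x \<in> \<Omega>. A x = b}. c \<bullet> x)"

definition slater_primal ::
  "(real ^ 'n \<Rightarrow> real ^ 'm) \<Rightarrow> real ^ 'm \<Rightarrow> (real ^ 'n) set \<Rightarrow> bool"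
  where "slater_primal A b \<Omega> \<longleftrightarrow> (\<exists>x \<in> rel_interior \<Omega>. A x = b)"

(* The dual minimizes g without explicit constraints, so its only implicit constraint is that y lies
   in the effective domain of g.  For compact \<Omega> that domain is the whole space, and the condition
   holds automatically. *)
definition slater_dual ::
  "(real ^ 'n \<Rightarrow> real ^ 'm) \<Rightarrow> real ^ 'm \<Rightarrow> real ^ 'n \<Rightarrow> (real ^ 'n) set \<Rightarrow> bool"
  where "slater_dual A b c \<Omega> \<longleftrightarrow>
    rel_interior {y. bdd_below ((\<lambda>x. lagr A b c x y) ` \<Omega>)} \<noteq> {}"

(* \<Omega>k is the current inner approximation, y the current centre and z the candidate. *)
definition descent_test ::
  "(real ^ 'n \<Rightarrow> real ^ 'm) \<Rightarrow> real ^ 'm \<Rightarrow> real ^ 'n \<Rightarrow> (real ^ 'n) set \<Rightarrow> real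
    \<Rightarrow> (real ^ 'n) set \<Rightarrow> real ^ 'm \<Rightarrow> real ^ 'm \<Rightarrow> bool"
  where "descent_test A b c \<Omega> \<beta> \<Omega>k y z \<longleftrightarrow>
    dual_fun A b c \<Omega> y - dual_fun A b c \<Omega> z \<ge>
      \<beta> * (dual_fun A b c \<Omega> y - dual_fun A b c \<Omega>k z)"

(* All sequences are indexed from 1; values at index 0 (and w 1, z 1) are irrelevant.
   The initial points x 1 and y 1 are arbitrary. *)
definition bala_run ::
  "(real ^ 'n \<Rightarrow> real ^ 'm) \<Rightarrow> real ^ 'm \<Rightarrow> real ^ 'n \<Rightarrow> (real ^ 'n) set \<Rightarrow> real \<Rightarrow> real
    \<Rightarrow> (nat \<Rightarrow> (real ^ 'n) set) \<Rightarrow> (nat \<Rightarrow> real ^ 'n) \<Rightarrow> (nat \<Rightarrow> real ^ 'm)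
    \<Rightarrow> (nat \<Rightarrow> real ^ 'n) \<Rightarrow> (nat \<Rightarrow> real ^ 'm) \<Rightarrow> bool"
  where "bala_run A b c \<Omega> \<rho> \<beta> \<Omega>s x y w z \<longleftrightarrow>
    \<Omega>s 1 \<noteq> {} \<and> closed (\<Omega>s 1) \<and> convex (\<Omega>s 1) \<and> \<Omega>s 1 \<subseteq> \<Omega> \<and>
    (\<forall>k\<ge>1.
      is_arg_min (\<lambda>u. aug_lagr A b c \<rho> u (y k)) (\<lambda>u. u \<in> \<Omega>s k) (w (Suc k)) \<and>
      z (Suc k) = y k + \<rho> *\<^sub>R (b - A (w (Suc k))) \<and>
      (if descent_test A b c \<Omega> \<beta> (\<Omega>s k) (y k) (z (Suc k))
       then x (Suc k) = w (Suc k) \<and> y (Suc k) = z (Suc k)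
       else x (Suc k) = x k \<and> y (Suc k) = y k) \<and>
      convex (\<Omega>s (Suc k)) \<and> closed (\<Omega>s (Suc k)) \<and> \<Omega>s (Suc k) \<subseteq> \<Omega> \<and>
      (\<exists>v\<in>\<Omega>. dual_fun A b c \<Omega> (z (Suc k)) = - lagr A b c v (z (Suc k)) \<and> v \<in> \<Omega>s (Suc k)) \<and>
      (\<not> descent_test A b c \<Omega> \<beta> (\<Omega>s k) (y k) (z (Suc k)) \<longrightarrow> w (Suc k) \<in> \<Omega>s (Suc k)))"

definition descent_steps ::
  "(real ^ 'n \<Rightarrow> real ^ 'm) \<Rightarrow> real ^ 'm \<Rightarrow> real ^ 'n \<Rightarrow> (real ^ 'n) set \<Rightarrow> real
    \<Rightarrow> (nat \<Rightarrow> (real ^ 'n) set) \<Rightarrow> (nat \<Rightarrow> real ^ 'm) \<Rightarrow> (nat \<Rightarrow> real ^ 'm) \<Rightarrow> nat set"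
  where "descent_steps A b c \<Omega> \<beta> \<Omega>s y z =
    {k. 1 \<le> k \<and> descent_test A b c \<Omega> \<beta> (\<Omega>s k) (y k) (z (Suc k))}"

end

theory Submission
  imports Defs
begin

text \<open>
  The method is the proximal bundle method applied to the dual function \<open>g\<close>: optimality of the
  augmented Lagrangian step says that \<open>z (k+1)\<close> is the proximal point of the model \<open>g\<^sub>k\<close> at \<open>y k\<close>,
  with subgradient \<open>A (w (k+1)) - b\<close>. Let \<open>\<delta> k = g (y k) - g\<^sub>k (z (k+1))\<close> be the predicted decrease.
  The descent test makes \<open>\<delta>\<close> summable over descent steps, so \<open>y\<close> is quasi-Fejer monotone with respect
  to the dual minimizers, which exist since Slater's condition makes \<open>g\<close> coercive modulo directions in
  which it is constant. If there are only finitely many descent steps, the optimal values of the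
  proximal subproblems increase to a limit, which forces \<open>z (k+1) - z k\<close>, hence \<open>\<delta>\<close>, to zero, so the
  final centre is a minimizer. Strong duality need not be proved separately: the limit points of \<open>x\<close>
  are feasible with objective value \<open>- min g\<close>.
\<close>

section \<open>Telescoping with summable errors; sequences that change only on an index set\<close>

section \<open>Real sequences\<close>

text \<open>Telescoping bounds the partial sums of \<open>d\<close> by
  \<open>a 0 + suminf s\<close>. The form with an error \<open>s\<close> serves the quasi-Fejer
  inequality; with \<open>s = 0\<close> it serves the model values in a null phase and the dual
  values.\<close>

lemma perturbed_descent:
  fixes a d s :: "nat \<Rightarrow> real"
  assumes step: "\<And>n. a (Suc n) + d n \<le> a n + s n"
    and a: "\<And>n. 0 \<le> a n" and d: "\<And>n. 0 \<le> d n" and s: "\<And>n. 0 \<le> s n" "summable s"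
  shows "summable d" and "convergent a"
proof -
  have bound: "a n + (\<Sum>k<n. d k) \<le> a 0 + (\<Sum>k<n. s k)" for n
  proof (induction n)
    case (Suc n)
    then show ?case using step[of n] by simp
  qed simp
  have "(\<Sum>k<n. d k) \<le> a 0 + suminf s" for n
    using bound[of n] a[of n] sum_le_suminf[OF s(2), of "{..<n}"] s(1) by simp
  then show "summable d"
    by (rule summableI_nonneg_bounded[OF d])
  \<comment> \<open>Subtracting the accumulated errors turns \<open>a\<close> into a decreasing
    sequence.\<close>
  define u where "u n = a n - (\<Sum>k<n. s k)" for n
  have "decseq u"
    unfolding u_def using step d by (intro decseq_SucI) (simp, smt (verit))
  moreover have "- suminf s \<le> u n" for n
    unfolding u_def using a[of n] sum_le_suminf[OF s(2), of "{..<n}"] s(1) by simp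
  ultimately obtain l where "u \<longlonglongrightarrow> l"
    using decseq_convergent by metis
  then have "(\<lambda>n. u n + (\<Sum>k<n. s k)) \<longlonglongrightarrow> l + suminf s"
    using s(2) by (intro tendsto_add summable_LIMSEQ)
  then show "convergent a"
    unfolding u_def convergent_def by auto
qed

text \<open>Past the first index of \<open>D\<close> beyond \<open>N\<close>, each
  \<open>x k\<close> is a copy of a value set at some index of \<open>D\<close> beyond
  \<open>N\<close>. This carries facts about descent steps across the null steps that
  follow.\<close>

lemma eventually_piecewise_constant:
  assumes inf: "infinite D"
    and jump: "\<And>k. k \<in> D \<Longrightarrow> N \<le> k \<Longrightarrow> P (x (Suc k))"
    and const: "\<And>k. 1 \<le> k \<Longrightarrow> k \<notin> D \<Longrightarrow> x (Suc k) = x k"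
  shows "eventually (\<lambda>k. P (x k)) sequentially"
proof -
  obtain k0 where k0: "k0 \<in> D" "N \<le> k0"
    using inf by (meson infinite_nat_iff_unbounded_le)
  have "P (x k)" if "Suc k0 \<le> k" for k
    using that
  proof (induction k rule: dec_induct)
    case base
    then show ?case using jump k0 by blast
  next
    case (step k)
    then show ?case
      using jump[of k] const[of k] k0 by (cases "k \<in> D") auto
  qed
  then show ?thesis
    unfolding eventually_sequentially by blast
qed

lemma tendsto_piecewise_constant:
  fixes h :: "'a \<Rightarrow> real"
  assumes "infinite D"
    and bound: "\<And>k. k \<in> D \<Longrightarrow> \<bar>h (x (Suc k))\<bar> \<le> r k" and r: "r \<longlonglongrightarrow> 0"
    and "\<And>k. 1 \<le> k \<Longrightarrow> k \<notin> D \<Longrightarrow> x (Suc k) = x k"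
  shows "(\<lambda>k. h (x k)) \<longlonglongrightarrow> 0"
proof (rule tendstoI)
  fix e :: real assume "0 < e"
  then obtain N where N: "\<And>k. N \<le> k \<Longrightarrow> r k < e"
    using order_tendstoD(2)[OF r] unfolding eventually_sequentially by blast
  show "eventually (\<lambda>k. dist (h (x k)) 0 < e) sequentially"
    by (rule eventually_piecewise_constant[where P = "\<lambda>u. dist (h u) 0 < e" and N = N and D = D])
      (use assms N in \<open>force+\<close>)
qed

section \<open>The dual function as a maximum of affine functions of the multiplier\<close>

section \<open>The dual function\<close>

lemma lagr_diff_dual: "lagr A b c x y' = lagr A b c x y + (y' - y) \<bullet> (b - A x)"
  by (simp add: lagr_def inner_diff_left)

lemma continuous_on_lagr:
  assumes "linear A"
  shows "continuous_on S (\<lambda>x. lagr A b c x y)"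
  unfolding lagr_def using linear_continuous_on[of A] assms
  by (intro continuous_intros) (auto simp: linear_conv_bounded_linear)

lemma dual_fun_ge:
  assumes "linear A" and "compact S" and "u \<in> S"
  shows "- lagr A b c u y \<le> dual_fun A b c S y"
  unfolding dual_fun_def
  using assms compact_continuous_image[OF continuous_on_lagr]
  by (auto intro!: cINF_lower bounded_imp_bdd_below compact_imp_bounded)

lemma dual_fun_eqI:
  assumes "v \<in> S" and "\<And>u. u \<in> S \<Longrightarrow> lagr A b c v y \<le> lagr A b c u y"
  shows "dual_fun A b c S y = - lagr A b c v y"
  unfolding dual_fun_def using assms by (intro arg_cong[where f = uminus] cInf_eq_minimum) auto

lemma dual_fun_attained:
  assumes "linear A" and "compact S" and "S \<noteq> {}"
  obtains v where "v \<in> S" and "dual_fun A b c S y = - lagr A b c v y"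
  using continuous_attains_inf[OF assms(2,3) continuous_on_lagr[OF assms(1)]] dual_fun_eqI by metis

lemma dual_fun_mono:
  assumes "linear A" and "compact T" and "compact S" and "S \<noteq> {}" and "S \<subseteq> T"
  shows "dual_fun A b c S y \<le> dual_fun A b c T y"
  using dual_fun_attained[OF assms(1,3,4)] dual_fun_ge[OF assms(1,2)] assms(5) by (metis subsetD)

lemma bounded_residual:
  fixes A :: "'a::euclidean_space \<Rightarrow> 'b::real_normed_vector"
  assumes "linear A" and "compact S"
  obtains M where "0 < M" and "\<And>x. x \<in> S \<Longrightarrow> norm (b - A x) \<le> M"
proof -
  have "compact ((\<lambda>x. b - A x) ` S)"
    using assms linear_continuous_on[of A]
    by (intro compact_continuous_image continuous_intros) (auto simp: linear_conv_bounded_linear)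
  then show ?thesis
    using that compact_imp_bounded[THEN bounded_pos[THEN iffD1]] by (metis imageI)
qed

text \<open>The affine pieces have slopes \<open>A x - b\<close> with \<open>x\<close> in
  \<open>S\<close>, so a bound on the residuals over \<open>S\<close> is a Lipschitz constant of
  their maximum.\<close>

lemma continuous_on_dual_fun:
  assumes "linear A" and "compact S" and "S \<noteq> {}"
  shows "continuous_on UNIV (dual_fun A b c S)"
proof -
  obtain M where M: "0 < M" "\<And>x. x \<in> S \<Longrightarrow> norm (b - A x) \<le> M"
    using bounded_residual[OF assms(1,2)] by metis
  have le: "dual_fun A b c S y - dual_fun A b c S y' \<le> M * dist y y'" for y y'
  proof -
    obtain v where v: "v \<in> S" "dual_fun A b c S y = - lagr A b c v y"
      using dual_fun_attained[OF assms] by metis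
    have "dual_fun A b c S y - dual_fun A b c S y' \<le> (y' - y) \<bullet> (b - A v)"
      using dual_fun_ge[OF assms(1,2) v(1), of b c y'] v(2) lagr_diff_dual[of A b c v y' y] by linarith
    also have "\<dots> \<le> norm (y' - y) * norm (b - A v)"
      by (rule norm_cauchy_schwarz)
    also have "\<dots> \<le> norm (y' - y) * M"
      using M v by (intro mult_left_mono) auto
    finally show ?thesis
      by (simp add: dist_norm norm_minus_commute mult.commute)
  qed
  have "M-lipschitz_on UNIV (dual_fun A b c S)"
    using le M(1) by (intro lipschitz_onI) (auto simp: dist_real_def abs_le_iff, metis dist_commute)
  then show ?thesis
    by (rule lipschitz_on_continuous_on)
qed

lemma dual_minimizer_exists:
  assumes "linear A" and "compact \<Omega>" and "convex \<Omega>" and "slater_primal A b \<Omega>"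
  obtains ystar where "\<And>y. dual_fun A b c \<Omega> ystar \<le> dual_fun A b c \<Omega> y"
proof -
  let ?g = "dual_fun A b c \<Omega>"
  obtain x0 where x0: "x0 \<in> rel_interior \<Omega>" "A x0 = b"
    using assms(4) by (auto simp: slater_primal_def)
  have ne: "\<Omega> \<noteq> {}"
    using x0 rel_interior_subset by blast
  define V where "V = span ((\<lambda>d. - b + d) ` (A ` \<Omega>))"
  have V: "A x - b \<in> V" if "x \<in> \<Omega>" for x
    unfolding V_def using that by (intro span_base) (auto simp: image_image)
  have "b \<in> rel_interior (A ` \<Omega>)"
    using rel_interior_convex_linear_image[OF assms(1,3)] x0 by (metis imageI)
  then obtain r where r: "0 < r" "cball b r \<inter> affine hull (A ` \<Omega>) \<subseteq> A ` \<Omega>" and "b \<in> A ` \<Omega>"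
    by (auto simp: mem_rel_interior_cball)
  then have hull: "affine hull (A ` \<Omega>) = (+) b ` V"
    unfolding V_def by (intro affine_hull_span_gen hull_inc)
  have "compact ((\<lambda>x. c \<bullet> x) ` \<Omega>)"
    using assms(2) by (intro compact_continuous_image continuous_intros)
  then obtain C where C: "\<And>x. x \<in> \<Omega> \<Longrightarrow> \<bar>c \<bullet> x\<bar> \<le> C"
    using compact_imp_bounded[THEN bounded_pos[THEN iffD1]] by (metis imageI real_norm_def)
  have coercive: "r * norm p - C \<le> ?g p" if "p \<in> V" for p
  proof -
    \<comment> \<open>Moving from \<open>b\<close> by \<open>r\<close> in direction \<open>p\<close>
      stays in the image of \<open>\<Omega>\<close>; a preimage supplies an affine piece that grows
      like \<open>r * norm p\<close>. For \<open>p = 0\<close> the quotient is 0 and the point is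
      \<open>b\<close>.\<close>
    let ?d = "b + (r / norm p) *\<^sub>R p"
    have "?d \<in> cball b r \<inter> affine hull (A ` \<Omega>)"
      using r that unfolding hull V_def by (auto simp: dist_norm intro!: span_scale)
    then obtain u where u: "u \<in> \<Omega>" "A u = ?d"
      using r by (metis imageE subsetD)
    have "p \<bullet> (b - A u) = - (r * norm p)"
      unfolding u by (simp add: dot_square_norm power2_eq_square)
    then show ?thesis
      using dual_fun_ge[OF assms(1,2) u(1), of b c p] C[OF u(1)] unfolding lagr_def by linarith
  qed
  have proj: "\<exists>p\<in>V. ?g y = ?g p" for y
  proof -
    obtain p q where pq: "p \<in> V" "\<And>v. v \<in> V \<Longrightarrow> orthogonal q v" "y = p + q"
      using orthogonal_subspace_decomp_exists[of "(\<lambda>d. - b + d) ` (A ` \<Omega>)" y] unfolding V_def by metis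
    have "lagr A b c x y = lagr A b c x p" if "x \<in> \<Omega>" for x
    proof -
      have "q \<bullet> (A x - b) = 0"
        using pq(2)[OF V[OF that]] by (simp add: orthogonal_def)
      then show ?thesis
        unfolding lagr_def pq(3) by (simp add: inner_diff_right inner_add_left)
    qed
    then show ?thesis
      using pq(1) unfolding dual_fun_def by (metis (no_types, lifting) INF_cong)
  qed
  \<comment> \<open>Points of \<open>V\<close> beyond this radius have a dual value above that at 0,
    by \<open>coercive\<close>.\<close>
  define K where "K = V \<inter> cball 0 (\<bar>?g 0 + C\<bar> / r)"
  have "compact K"
    unfolding K_def V_def by (intro closed_Int_compact closed_subspace subspace_span compact_cball)
  moreover have K0: "0 \<in> K"
    unfolding K_def V_def using r by (simp add: span_zero)
  ultimately obtain ystar where ystar: "\<And>p. p \<in> K \<Longrightarrow> ?g ystar \<le> ?g p"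
    using continuous_attains_inf[of K ?g] continuous_on_subset[OF continuous_on_dual_fun[OF assms(1,2) ne]]
    by (metis empty_iff subset_UNIV)
  have "?g ystar \<le> ?g y" for y
  proof -
    obtain p where p: "p \<in> V" "?g y = ?g p"
      using proj by blast
    show ?thesis
    proof (cases "p \<in> K")
      case False
      then have "\<bar>?g 0 + C\<bar> < r * norm p"
        using p r unfolding K_def by (simp add: field_simps)
      then show ?thesis
        using coercive[OF p(1)] ystar[OF K0] p(2) by linarith
    qed (use ystar p in simp)
  qed
  then show ?thesis
    using that by blast
qed

section \<open>First-order optimality of the augmented Lagrangian step\<close>

section \<open>The augmented Lagrangian step\<close>

text \<open>The directional derivative of the augmented Lagrangian at \<open>w\<close> towards
  \<open>u\<close> is the difference of the ordinary Lagrangians at the shifted multiplier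
  \<open>z\<close>. It is nonnegative at a minimizer over a convex set.\<close>

lemma aug_lagr_arg_min_imp_lagr_min:
  assumes "linear A" and "convex S"
    and w: "is_arg_min (\<lambda>u. aug_lagr A b c \<rho> u y) (\<lambda>u. u \<in> S) w"
    and z: "z = y + \<rho> *\<^sub>R (b - A w)" and "u \<in> S"
  shows "lagr A b c w z \<le> lagr A b c u z"
proof -
  define d where "d = u - w"
  define \<gamma> where "\<gamma> = \<rho> / 2 * (norm (A d))\<^sup>2"
  have wS: "w \<in> S"
    using w by (simp add: is_arg_min_linorder)
  have A: "A (w + t *\<^sub>R d) = A w + t *\<^sub>R A d" for t
    using assms(1) by (simp add: linear_add linear_scale)
  have diff: "lagr A b c u z - lagr A b c w z = c \<bullet> d - z \<bullet> A d"
    unfolding lagr_def d_def using assms(1) by (simp add: linear_diff inner_diff_right)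
  have "0 \<le> c \<bullet> d - z \<bullet> A d + t * \<gamma>" if t: "0 < t" "t \<le> 1" for t
  proof -
    have "w + t *\<^sub>R d = (1 - t) *\<^sub>R w + t *\<^sub>R u"
      by (simp add: d_def algebra_simps)
    then have "w + t *\<^sub>R d \<in> S"
      using convexD[OF assms(2) wS assms(5), of "1 - t" t] t by simp
    then have "aug_lagr A b c \<rho> w y \<le> aug_lagr A b c \<rho> (w + t *\<^sub>R d) y"
      using w by (simp add: is_arg_min_linorder)
    \<comment> \<open>The expansion is exact, since the function is quadratic along the segment; the
      linear part of the penalty turns \<open>y\<close> into \<open>z\<close>.\<close>
    moreover have "aug_lagr A b c \<rho> (w + t *\<^sub>R d) y
        = aug_lagr A b c \<rho> w y + t * (c \<bullet> d - z \<bullet> A d + t * \<gamma>)"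
      unfolding aug_lagr_def lagr_def A z \<gamma>_def power2_norm_eq_inner
      by (simp add: inner_commute algebra_simps power2_eq_square)
    ultimately have "0 \<le> t * (c \<bullet> d - z \<bullet> A d + t * \<gamma>)"
      by linarith
    then show ?thesis
      using t by (simp add: zero_le_mult_iff)
  qed
  then have "eventually (\<lambda>t. 0 \<le> c \<bullet> d - z \<bullet> A d + t * \<gamma>) (at_right 0)"
    by (intro eventually_at_right_less[THEN eventually_mono] eventually_at_rightI[of 0 1]) auto
  moreover have "((\<lambda>t. c \<bullet> d - z \<bullet> A d + t * \<gamma>) \<longlongrightarrow> c \<bullet> d - z \<bullet> A d + 0 * \<gamma>) (at_right 0)"
    by (intro tendsto_intros)
  ultimately have "0 \<le> c \<bullet> d - z \<bullet> A d + 0 * \<gamma>"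
    by (intro tendsto_lowerbound) auto
  then show ?thesis
    using diff by simp
qed

section \<open>The update as a proximal step on the model\<close>

section \<open>Runs of the algorithm\<close>

locale bala =
  fixes A :: "real ^ 'n \<Rightarrow> real ^ 'm" and b :: "real ^ 'm" and c :: "real ^ 'n"
    and \<Omega> :: "(real ^ 'n) set" and \<rho> \<beta> :: real
    and \<Omega>s :: "nat \<Rightarrow> (real ^ 'n) set"
    and x w :: "nat \<Rightarrow> real ^ 'n" and y z :: "nat \<Rightarrow> real ^ 'm"
  assumes compact: "compact \<Omega>" and convex: "convex \<Omega>" and linear: "linear A"
    and slater: "slater_primal A b \<Omega>"
    and rho: "0 < \<rho>" and beta: "0 < \<beta>" "\<beta> < 1"
    and run: "bala_run A b c \<Omega> \<rho> \<beta> \<Omega>s x y w z"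
begin

abbreviation "L \<equiv> lagr A b c"
abbreviation "g \<equiv> dual_fun A b c \<Omega>"
abbreviation "g_mod k \<equiv> dual_fun A b c (\<Omega>s k)"
abbreviation "D \<equiv> descent_steps A b c \<Omega> \<beta> \<Omega>s y z"

definition pred_decrease :: "nat \<Rightarrow> real"
  where "pred_decrease k = g (y k) - g_mod k (z (Suc k))"

lemma
  assumes "1 \<le> k"
  shows arg_min: "is_arg_min (\<lambda>u. aug_lagr A b c \<rho> u (y k)) (\<lambda>u. u \<in> \<Omega>s k) (w (Suc k))"
    and z_Suc: "z (Suc k) = y k + \<rho> *\<^sub>R (b - A (w (Suc k)))"
    and descent: "k \<in> D \<Longrightarrow> x (Suc k) = w (Suc k)" "k \<in> D \<Longrightarrow> y (Suc k) = z (Suc k)"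
    and null: "k \<notin> D \<Longrightarrow> x (Suc k) = x k" "k \<notin> D \<Longrightarrow> y (Suc k) = y k"
      "k \<notin> D \<Longrightarrow> w (Suc k) \<in> \<Omega>s (Suc k)"
    and oracle_point: "\<exists>v\<in>\<Omega>s (Suc k). g (z (Suc k)) = - L v (z (Suc k))"
  using run assms unfolding bala_run_def descent_steps_def by auto

lemma descent_decrease: "k \<in> D \<Longrightarrow> \<beta> * pred_decrease k \<le> g (y k) - g (y (Suc k))"
  using descent unfolding descent_steps_def descent_test_def pred_decrease_def by auto

lemma null_decrease: "1 \<le> k \<Longrightarrow> k \<notin> D \<Longrightarrow> g (y k) - g (z (Suc k)) < \<beta> * pred_decrease k"
  unfolding descent_steps_def descent_test_def pred_decrease_def by auto

lemma model_set:
  assumes "1 \<le> k"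
  shows "\<Omega>s k \<subseteq> \<Omega>" and "convex (\<Omega>s k)" and "compact (\<Omega>s k)" and "\<Omega>s k \<noteq> {}"
proof -
  have "\<Omega>s k \<subseteq> \<Omega> \<and> convex (\<Omega>s k) \<and> closed (\<Omega>s k) \<and> \<Omega>s k \<noteq> {}"
  proof (cases "k = 1")
    \<comment> \<open>After the first index, the oracle point witnesses nonemptiness.\<close>
    case False
    then obtain j where "k = Suc j" "1 \<le> j"
      using assms by (cases k) auto
    then show ?thesis
      using run unfolding bala_run_def by blast
  qed (use run in \<open>simp add: bala_run_def\<close>)
  then show "\<Omega>s k \<subseteq> \<Omega>" and "convex (\<Omega>s k)" and "compact (\<Omega>s k)" and "\<Omega>s k \<noteq> {}"
    using compact closed_Int_compact[of "\<Omega>s k" \<Omega>] by (auto simp: Int_absorb2)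
qed

lemma w_in: "1 \<le> k \<Longrightarrow> w (Suc k) \<in> \<Omega>s k"
  using arg_min by (simp add: is_arg_min_linorder)

lemma model_le: "1 \<le> k \<Longrightarrow> g_mod k u \<le> g u"
  by (rule dual_fun_mono[OF linear compact model_set(3,4,1)])

lemma model_ge: "1 \<le> k \<Longrightarrow> v \<in> \<Omega>s k \<Longrightarrow> - L v u \<le> g_mod k u"
  by (rule dual_fun_ge[OF linear model_set(3)])

lemma model_at_z: "1 \<le> k \<Longrightarrow> g_mod k (z (Suc k)) = - L (w (Suc k)) (z (Suc k))"
  by (intro dual_fun_eqI w_in aug_lagr_arg_min_imp_lagr_min[OF linear model_set(2) arg_min z_Suc])

lemma residual: "1 \<le> k \<Longrightarrow> b - A (w (Suc k)) = (1 / \<rho>) *\<^sub>R (z (Suc k) - y k)"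
  by (subst z_Suc) (use rho in simp_all)

text \<open>This is the aggregate cut of bundle methods: the affine piece belonging to
  \<open>w (Suc k)\<close> touches the model at \<open>z (Suc k)\<close> and has slope
  \<open>(y k - z (Suc k)) / \<rho>\<close>. Retaining \<open>w (Suc k)\<close> after a null step
  keeps this cut in the next model.\<close>

lemma lagr_w:
  assumes "1 \<le> k"
  shows "- L (w (Suc k)) u = g_mod k (z (Suc k)) + (y k - z (Suc k)) \<bullet> (u - z (Suc k)) / \<rho>"
proof -
  have "(u - z (Suc k)) \<bullet> (b - A (w (Suc k))) = - ((y k - z (Suc k)) \<bullet> (u - z (Suc k)) / \<rho>)"
    unfolding residual[OF assms] using inner_commute[of "u - z (Suc k)" "z (Suc k) - y k"]
      inner_minus_left[of "z (Suc k) - y k" "u - z (Suc k)"] by simp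
  then show ?thesis
    using lagr_diff_dual[of A b c "w (Suc k)" u "z (Suc k)"] model_at_z[OF assms] by linarith
qed

text \<open>The aggregate cut lies below the model, so its slope is a subgradient there; this
  characterizes \<open>z (Suc k)\<close> as the proximal point of the model at
  \<open>y k\<close>.\<close>

lemma prox_subgradient:
  assumes "1 \<le> k"
  shows "g_mod k (z (Suc k)) + (y k - z (Suc k)) \<bullet> (u - z (Suc k)) / \<rho> \<le> g_mod k u"
  using lagr_w[OF assms, of u] model_ge[OF assms w_in[OF assms], of u] by simp

text \<open>Three-point inequality: polarization turns the inner product in the subgradient
  inequality into squared distances. It is used with \<open>u\<close> the centre and with
  \<open>u\<close> a dual minimizer.\<close>

lemma prox_distance:
  assumes "1 \<le> k"
  shows "(norm (z (Suc k) - u))\<^sup>2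
    \<le> (norm (y k - u))\<^sup>2 - (norm (z (Suc k) - y k))\<^sup>2 + 2 * \<rho> * (g u - g_mod k (z (Suc k)))"
proof -
  have id: "(norm (z (Suc k) - u))\<^sup>2
      = (norm (y k - u))\<^sup>2 - (norm (z (Suc k) - y k))\<^sup>2 + 2 * ((y k - z (Suc k)) \<bullet> (u - z (Suc k)))"
    using dot_norm_neg[of "y k - z (Suc k)" "u - z (Suc k)"] by (simp add: norm_minus_commute)
  have "(y k - z (Suc k)) \<bullet> (u - z (Suc k)) / \<rho> \<le> g u - g_mod k (z (Suc k))"
    using prox_subgradient[OF assms, of u] model_le[OF assms, of u] by linarith
  then have "2 * ((y k - z (Suc k)) \<bullet> (u - z (Suc k))) \<le> 2 * \<rho> * (g u - g_mod k (z (Suc k)))"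
    using rho by (simp add: field_simps)
  then show ?thesis
    using id by linarith
qed

lemma pred_decrease_ge:
  assumes "1 \<le> k"
  shows "(norm (z (Suc k) - y k))\<^sup>2 \<le> \<rho> * pred_decrease k"
  using prox_distance[OF assms, of "y k"] unfolding pred_decrease_def by simp

lemma pred_decrease_nonneg:
  assumes "1 \<le> k"
  shows "0 \<le> pred_decrease k"
proof -
  have "0 \<le> \<rho> * pred_decrease k"
    by (rule order_trans[OF zero_le_power2 pred_decrease_ge[OF assms]])
  then show ?thesis
    using rho by (simp add: zero_le_mult_iff)
qed

section \<open>An infinite tail of null steps with a fixed centre\<close>

subsection \<open>Finitely many descent steps\<close>

lemma centre_constant:
  assumes N: "1 \<le> N" "\<And>k. N \<le> k \<Longrightarrow> k \<notin> D" and "N \<le> k"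
  shows "y k = y N"
  using assms(3)
proof (induction k rule: dec_induct)
  case (step k)
  then show ?case
    using null(2)[of k] N by simp
qed simp

text \<open>The two points retained in \<open>\<Omega>s (Suc k)\<close> do different work:
  \<open>w (Suc k)\<close> makes the subproblem values increase, so successive candidates approach
  each other; the oracle point makes the next model exact at \<open>z (Suc k)\<close>, so its error
  at the next candidate vanishes.\<close>

lemma null_phase_limit:
  assumes N: "1 \<le> N" "\<And>k. N \<le> k \<Longrightarrow> k \<notin> D"
  shows "pred_decrease \<longlonglongrightarrow> 0"
proof -
  have y: "y k = y N" if "N \<le> k" for k
    using centre_constant[of N k] N that by simp
  \<comment> \<open>The optimal value of the proximal subproblem with centre
    \<open>y N\<close>.\<close>
  define m where "m k = g_mod k (z (Suc k)) + (norm (z (Suc k) - y N))\<^sup>2 / (2 * \<rho>)" for k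
  \<comment> \<open>The retained aggregate cut plus the quadratic term is a parabola with minimum
    \<open>m k\<close> at \<open>z (Suc k)\<close>, which gives the quadratic gain.\<close>
  have step: "m k + (norm (z (Suc (Suc k)) - z (Suc k)))\<^sup>2 / (2 * \<rho>) \<le> m (Suc k)"
    if k: "N \<le> k" for k
  proof -
    have "g_mod k (z (Suc k)) + (y N - z (Suc k)) \<bullet> (z (Suc (Suc k)) - z (Suc k)) / \<rho>
        \<le> g_mod (Suc k) (z (Suc (Suc k)))"
      using lagr_w[of k "z (Suc (Suc k))"] model_ge[of "Suc k" "w (Suc k)" "z (Suc (Suc k))"] null(3)[of k] N k y[OF k]
      by auto
    then show ?thesis
      unfolding m_def dot_norm_neg
      by (simp add: norm_minus_commute add_divide_distrib diff_divide_distrib)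
  qed
  have m_le: "m k \<le> g (y N)" if k: "N \<le> k" for k
  proof -
    have "1 \<le> k" using N k by linarith
    then have "(norm (z (Suc k) - y N))\<^sup>2 / \<rho> \<le> pred_decrease k"
      using pred_decrease_ge[of k] y[OF k] rho by (simp add: field_simps)
    moreover have "(norm (z (Suc k) - y N))\<^sup>2 / (2 * \<rho>) \<le> (norm (z (Suc k) - y N))\<^sup>2 / \<rho>"
      using rho by (simp add: field_simps)
    ultimately show ?thesis
      unfolding m_def pred_decrease_def y[OF k] by linarith
  qed
  have "summable (\<lambda>k. (norm (z (Suc (Suc (k + N))) - z (Suc (k + N))))\<^sup>2 / (2 * \<rho>))"
  proof (rule perturbed_descent(1))
    show "g (y N) - m (Suc k + N) + (norm (z (Suc (Suc (k + N))) - z (Suc (k + N))))\<^sup>2 / (2 * \<rho>)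
        \<le> g (y N) - m (k + N) + 0" for k
      using step[of "k + N"] by simp
  qed (use m_le rho in auto)
  then have "(\<lambda>k. (norm (z (Suc (Suc (k + N))) - z (Suc (k + N))))\<^sup>2 / (2 * \<rho>)) \<longlonglongrightarrow> 0"
    by (rule summable_LIMSEQ_zero)
  then have "(\<lambda>k. (2 * \<rho>) * ((norm (z (Suc (Suc (k + N))) - z (Suc (k + N))))\<^sup>2 / (2 * \<rho>))) \<longlonglongrightarrow> 0"
    by (rule tendsto_mult_right_zero)
  then have "(\<lambda>k. sqrt ((norm (z (Suc (Suc (k + N))) - z (Suc (k + N))))\<^sup>2)) \<longlonglongrightarrow> sqrt 0"
    using rho by (intro tendsto_real_sqrt) simp
  then have dz: "(\<lambda>k. norm (z (Suc (Suc (k + N))) - z (Suc (k + N)))) \<longlonglongrightarrow> 0"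
    by simp
  obtain M where M: "0 < M" "\<And>u. u \<in> \<Omega> \<Longrightarrow> norm (b - A u) \<le> M"
    using bounded_residual[OF linear compact] by metis
  \<comment> \<open>The failed descent test bounds the left side by the model error at the new
    candidate. That error is at most the difference of two affine pieces, each changing by at most
    \<open>M\<close> times the distance moved.\<close>
  have bound: "(1 - \<beta>) * pred_decrease (Suc k) \<le> 2 * M * norm (z (Suc (Suc k)) - z (Suc k))"
    if k: "N \<le> k" for k
  proof -
    have k1: "1 \<le> k" "1 \<le> Suc k" using N k by linarith+
    obtain v where v: "v \<in> \<Omega>s (Suc k)" "g (z (Suc k)) = - L v (z (Suc k))"
      using oracle_point k1 by blast
    obtain v' where v': "v' \<in> \<Omega>s (Suc (Suc k))" "g (z (Suc (Suc k))) = - L v' (z (Suc (Suc k)))"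
      using oracle_point k1 by blast
    have in\<Omega>: "v \<in> \<Omega>" "v' \<in> \<Omega>"
      using v v' model_set(1)[of "Suc k"] model_set(1)[of "Suc (Suc k)"] by auto
    let ?d = "z (Suc (Suc k)) - z (Suc k)"
    have inner: "\<bar>?d \<bullet> (b - A u)\<bar> \<le> M * norm ?d" if "u \<in> \<Omega>" for u
    proof -
      have "\<bar>?d \<bullet> (b - A u)\<bar> \<le> norm ?d * norm (b - A u)"
        by (rule Cauchy_Schwarz_ineq2)
      also have "\<dots> \<le> norm ?d * M"
        using M(2)[OF that] by (intro mult_left_mono) auto
      finally show ?thesis by (simp add: mult.commute)
    qed
    have "g (z (Suc (Suc k))) - g_mod (Suc k) (z (Suc (Suc k)))
        \<le> - L v' (z (Suc (Suc k))) + L v (z (Suc (Suc k)))"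
      using model_ge[OF k1(2) v(1)] v'(2) by (metis add.commute diff_left_mono diff_minus_eq_add)
    also have "\<dots> \<le> ?d \<bullet> (b - A v) - ?d \<bullet> (b - A v')"
      using dual_fun_ge[OF linear compact in\<Omega>(2), of b c "z (Suc k)"] v(2)
        lagr_diff_dual[of A b c v "z (Suc (Suc k))" "z (Suc k)"]
        lagr_diff_dual[of A b c v' "z (Suc (Suc k))" "z (Suc k)"] by linarith
    also have "\<dots> \<le> 2 * M * norm ?d"
      using inner[OF in\<Omega>(1)] inner[OF in\<Omega>(2)] by linarith
    finally show ?thesis
      using null_decrease[of "Suc k"] N k k1 unfolding pred_decrease_def
      by (simp add: algebra_simps)
  qed
  have "(\<lambda>k. pred_decrease (Suc (k + N))) \<longlonglongrightarrow> 0"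
  proof (rule tendsto_sandwich[OF _ _ tendsto_const])
    show "(\<lambda>k. (2 * M / (1 - \<beta>)) * norm (z (Suc (Suc (k + N))) - z (Suc (k + N)))) \<longlonglongrightarrow> 0"
      using dz by (rule tendsto_mult_right_zero)
    show "\<forall>\<^sub>F k in sequentially. pred_decrease (Suc (k + N))
        \<le> (2 * M / (1 - \<beta>)) * norm (z (Suc (Suc (k + N))) - z (Suc (k + N)))"
      using bound beta by (intro always_eventually allI) (simp add: field_simps)
  qed (simp add: pred_decrease_nonneg)
  then show ?thesis
    using LIMSEQ_offset[of pred_decrease "Suc N"] by simp
qed

text \<open>By \<open>pred_decrease_ge\<close> the vanishing predicted decrease drives the
  candidates to the centre; the subgradient inequality then passes to the limit.\<close>

lemma null_phase_minimizer:
  assumes N: "1 \<le> N" "\<And>k. N \<le> k \<Longrightarrow> k \<notin> D"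
  shows "g (y N) \<le> g u"
proof -
  have y: "y k = y N" if "N \<le> k" for k
    using centre_constant[of N k] N that by simp
  have dec: "pred_decrease \<longlonglongrightarrow> 0"
    using N by (rule null_phase_limit)
  have "(\<lambda>k. sqrt (\<rho> * pred_decrease k)) \<longlonglongrightarrow> sqrt (\<rho> * 0)"
    using dec by (intro tendsto_intros)
  then have lim: "(\<lambda>k. sqrt (\<rho> * pred_decrease k)) \<longlonglongrightarrow> 0"
    by simp
  have z: "(\<lambda>k. z (Suc k)) \<longlonglongrightarrow> y N"
  proof (rule Lim_transform_eventually)
    have "\<forall>\<^sub>F k in sequentially. norm (z (Suc k) - y k) \<le> sqrt (\<rho> * pred_decrease k)"
      by (intro eventually_sequentiallyI[of 1] real_le_rsqrt pred_decrease_ge)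
    then have "(\<lambda>k. z (Suc k) - y k) \<longlonglongrightarrow> 0"
      by (rule Lim_null_comparison) (rule lim)
    then show "(\<lambda>k. z (Suc k) - y k + y N) \<longlonglongrightarrow> y N"
      using tendsto_add[OF _ tendsto_const[of "y N"]] by fastforce
    show "\<forall>\<^sub>F k in sequentially. z (Suc k) - y k + y N = z (Suc k)"
    proof (rule eventually_sequentiallyI)
      fix k assume "N \<le> k"
      then show "z (Suc k) - y k + y N = z (Suc k)"
        by (subst y) simp_all
    qed
  qed
  have "(\<lambda>k. g (y N) - pred_decrease k + (y N - z (Suc k)) \<bullet> (u - z (Suc k)) / \<rho>)
      \<longlonglongrightarrow> g (y N) - 0 + (y N - y N) \<bullet> (u - y N) / \<rho>"
    using dec z rho by (intro tendsto_intros) auto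
  moreover have "\<forall>\<^sub>F k in sequentially.
      g (y N) - pred_decrease k + (y N - z (Suc k)) \<bullet> (u - z (Suc k)) / \<rho> \<le> g u"
  proof (intro eventually_sequentiallyI[of N])
    fix k assume k: "N \<le> k"
    then have "1 \<le> k" using N by linarith
    then show "g (y N) - pred_decrease k + (y N - z (Suc k)) \<bullet> (u - z (Suc k)) / \<rho> \<le> g u"
      using prox_subgradient[of k u] model_le[of k u] y[OF k] unfolding pred_decrease_def by simp
  qed
  ultimately have "g (y N) - 0 + (y N - y N) \<bullet> (u - y N) / \<rho> \<le> g u"
    by (rule tendsto_upperbound) simp
  then show ?thesis
    by simp
qed

section \<open>Quasi-Fejer monotonicity and convergence of the centres\<close>

subsection \<open>Infinitely many descent steps\<close>

text \<open>Set to zero at null steps, so that the recursions can be summed over all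
  indices.\<close>

definition descent_decr :: "nat \<Rightarrow> real"
  where "descent_decr k = (if k \<in> D then pred_decrease k else 0)"

lemma dual_decrease: "1 \<le> k \<Longrightarrow> g (y (Suc k)) + \<beta> * descent_decr k \<le> g (y k)"
  using descent_decrease[of k] null(2)[of k] unfolding descent_decr_def by auto

text \<open>Each descent step lowers the dual value by at least \<open>\<beta>\<close> times the
  predicted decrease, and the dual value is bounded below. The shift by \<open>Suc\<close> skips the
  irrelevant index 0.\<close>

lemma summable_descent_decr: "summable (\<lambda>k. descent_decr (Suc k))"
proof -
  obtain ystar where min: "\<And>u. g ystar \<le> g u"
    using dual_minimizer_exists[OF linear compact convex slater] by metis
  have "summable (\<lambda>k. \<beta> * descent_decr (Suc k))"
  proof (rule perturbed_descent(1))
    show "g (y (Suc (Suc k))) - g ystar + \<beta> * descent_decr (Suc k) \<le> g (y (Suc k)) - g ystar + 0" for k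
      using dual_decrease[of "Suc k"] by simp
  qed (use min beta pred_decrease_nonneg in \<open>auto simp: descent_decr_def\<close>)
  then show ?thesis
    using beta by (simp add: summable_cmult_iff)
qed

text \<open>At a descent step this is \<open>prox_distance\<close> at \<open>ystar\<close> without
  its negative square; the gap to the model splits into the predicted decrease minus the dual
  gap.\<close>

lemma quasi_fejer:
  assumes min: "\<And>u. g ystar \<le> g u" and k: "1 \<le> k"
  shows "(norm (y (Suc k) - ystar))\<^sup>2 + 2 * \<rho> * (if k \<in> D then g (y k) - g ystar else 0)
    \<le> (norm (y k - ystar))\<^sup>2 + 2 * \<rho> * descent_decr k"
proof (cases "k \<in> D")
  case True
  have "(norm (z (Suc k) - ystar))\<^sup>2
      \<le> (norm (y k - ystar))\<^sup>2 + 2 * \<rho> * (g ystar - g_mod k (z (Suc k)))"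
    using prox_distance[OF k, of ystar] zero_le_power2[of "norm (z (Suc k) - y k)"] by linarith
  then show ?thesis
    using True descent(2)[OF k] by (simp add: descent_decr_def pred_decrease_def algebra_simps)
qed (use null(2) k in \<open>simp add: descent_decr_def\<close>)

lemma
  assumes min: "\<And>u. g ystar \<le> g u"
  shows convergent_distance: "convergent (\<lambda>k. (norm (y (Suc k) - ystar))\<^sup>2)"
    and summable_gap: "summable (\<lambda>k. 2 * \<rho> * (if Suc k \<in> D then g (y (Suc k)) - g ystar else 0))"
proof -
  note facts = quasi_fejer[OF min, of "Suc k" for k]
  have nonneg: "0 \<le> 2 * \<rho> * (if Suc k \<in> D then g (y (Suc k)) - g ystar else 0)"
    "0 \<le> 2 * \<rho> * descent_decr (Suc k)" for k
    using min rho pred_decrease_nonneg by (auto simp: descent_decr_def)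
  have sum: "summable (\<lambda>k. 2 * \<rho> * descent_decr (Suc k))"
    using summable_descent_decr by (rule summable_mult)
  show "convergent (\<lambda>k. (norm (y (Suc k) - ystar))\<^sup>2)"
    by (rule perturbed_descent(2)[OF facts _ nonneg sum]) auto
  show "summable (\<lambda>k. 2 * \<rho> * (if Suc k \<in> D then g (y (Suc k)) - g ystar else 0))"
    by (rule perturbed_descent(1)[OF facts _ nonneg sum]) auto
qed

text \<open>Summability makes the gap small at some late descent step, and monotonicity of the dual
  values keeps it small afterwards.\<close>

lemma dual_value_limit:
  assumes inf: "infinite D" and min: "\<And>u. g ystar \<le> g u"
  shows "(\<lambda>k. g (y k)) \<longlonglongrightarrow> g ystar"
proof (rule tendstoI)
  fix e :: real assume e: "0 < e"
  have lim: "(\<lambda>k. 2 * \<rho> * (if Suc k \<in> D then g (y (Suc k)) - g ystar else 0)) \<longlonglongrightarrow> 0"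
    using summable_gap[OF min] by (rule summable_LIMSEQ_zero)
  have "\<forall>\<^sub>F k in sequentially. 2 * \<rho> * (if Suc k \<in> D then g (y (Suc k)) - g ystar else 0) < 2 * \<rho> * e"
    using rho e by (intro order_tendstoD(2)[OF lim]) simp
  then obtain N where *: "\<And>k. N \<le> k \<Longrightarrow> 2 * \<rho> * (if Suc k \<in> D then g (y (Suc k)) - g ystar else 0) < 2 * \<rho> * e"
    unfolding eventually_sequentially by blast
  have N: "g (y (Suc k)) - g ystar < e" if "N \<le> k" "Suc k \<in> D" for k
    using that(2) rho *[OF that(1)] by simp
  obtain j where j: "j \<in> D" "Suc N \<le> j"
    using inf by (meson infinite_nat_iff_unbounded_le)
  have "g (y k) - g ystar < e" if "j \<le> k" for k
    using that
  proof (induction k rule: dec_induct)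
    case base
    then show ?case using N[of "j - 1"] j by auto
  next
    case (step k)
    have "0 \<le> \<beta> * descent_decr k"
      using step j pred_decrease_nonneg beta by (simp add: descent_decr_def)
    then show ?case
      using dual_decrease[of k] step j by linarith
  qed
  then show "\<forall>\<^sub>F k in sequentially. dist (g (y k)) (g ystar) < e"
    using min by (intro eventually_sequentiallyI[of j]) (simp add: dist_real_def)
qed

lemma Omega_nonempty: "\<Omega> \<noteq> {}"
  using slater rel_interior_subset by (auto simp: slater_primal_def)

text \<open>With finitely many descent steps the final centre is the limit. Otherwise the distance
  to every minimizer converges, and a cluster point is itself a minimizer.\<close>

lemma dual_convergence:
  obtains ystar where "\<And>u. g ystar \<le> g u" and "y \<longlonglongrightarrow> ystar"
proof (cases "finite D")
  case True
  then obtain N where N: "\<And>k. N \<le> k \<Longrightarrow> k \<notin> D"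
    by (metis finite_nat_set_iff_bounded leD)
  have "y k = y (Suc N)" if "Suc N \<le> k" for k
    using centre_constant[of "Suc N" k] N that by simp
  then have "y \<longlonglongrightarrow> y (Suc N)"
    by (intro tendsto_eventually eventually_sequentiallyI)
  moreover have "g (y (Suc N)) \<le> g u" for u
    using N by (intro null_phase_minimizer) auto
  ultimately show ?thesis
    using that by blast
next
  case False
  obtain y0 where y0: "\<And>u. g y0 \<le> g u"
    using dual_minimizer_exists[OF linear compact convex slater] by metis
  have cont: "continuous_on UNIV g"
    using continuous_on_dual_fun[OF linear compact Omega_nonempty] .
  obtain B where B: "\<And>k. norm ((norm (y (Suc k) - y0))\<^sup>2) \<le> B"
    using convergent_distance[OF y0, THEN convergent_imp_Bseq] unfolding Bseq_def by blast
  have "y (Suc k) \<in> cball y0 (sqrt B)" for k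
    using B[of k] by (auto simp: dist_norm norm_minus_commute intro: real_le_rsqrt)
  then obtain l r where r: "strict_mono r" and l: "((\<lambda>k. y (Suc k)) \<circ> r) \<longlonglongrightarrow> l"
    using compact_cball[of y0 "sqrt B", unfolded compact_def] by metis
  have "(\<lambda>k. g (y (Suc (r k)))) \<longlonglongrightarrow> g l"
    using continuous_on_tendsto_compose[OF cont l] by (simp add: o_def)
  moreover have "(\<lambda>k. g (y (Suc (r k)))) \<longlonglongrightarrow> g y0"
    using LIMSEQ_subseq_LIMSEQ[OF LIMSEQ_Suc[OF dual_value_limit[OF False y0]] r] by (simp add: o_def)
  ultimately have l_min: "g l \<le> g u" for u
    using y0 LIMSEQ_unique by metis
  \<comment> \<open>Distance convergence is applied to the cluster point itself; the subsequence
    forces the limit \<open>a\<close> to be 0.\<close>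
  obtain a where a: "(\<lambda>k. (norm (y (Suc k) - l))\<^sup>2) \<longlonglongrightarrow> a"
    using convergent_distance[OF l_min] by (auto simp: convergent_def)
  moreover have "(\<lambda>k. (norm (((\<lambda>k. y (Suc k)) \<circ> r) k - l))\<^sup>2) \<longlonglongrightarrow> (norm (l - l))\<^sup>2"
    using l by (intro tendsto_intros)
  moreover have "(\<lambda>k. (norm (((\<lambda>k. y (Suc k)) \<circ> r) k - l))\<^sup>2) \<longlonglongrightarrow> a"
    using LIMSEQ_subseq_LIMSEQ[OF a r] by (simp add: o_def)
  ultimately have "a = (norm (l - l))\<^sup>2"
    by (intro LIMSEQ_unique)
  then have "(\<lambda>k. sqrt ((norm (y (Suc k) - l))\<^sup>2)) \<longlonglongrightarrow> sqrt 0"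
    using a by (intro tendsto_real_sqrt) simp
  then have "(\<lambda>k. y (Suc k) - l) \<longlonglongrightarrow> 0"
    by (simp add: tendsto_norm_zero_iff)
  then have "(\<lambda>k. y (Suc k)) \<longlonglongrightarrow> l"
    by (rule LIM_zero_cancel)
  then show ?thesis
    by (rule that[OF l_min LIMSEQ_imp_Suc])
qed

section \<open>Feasibility, objective values and strong duality in the limit\<close>

subsection \<open>Primal convergence\<close>

text \<open>At a descent step the residual is the step of \<open>y\<close> divided by
  \<open>\<rho>\<close>, and \<open>y\<close> converges.\<close>

lemma primal_residual_limit:
  assumes inf: "infinite D"
  shows "(\<lambda>k. norm (A (x k) - b)) \<longlonglongrightarrow> 0"
proof (rule tendsto_piecewise_constant[where h = "\<lambda>u. norm (A u - b)", OF inf])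
  obtain ystar where ystar: "y \<longlonglongrightarrow> ystar"
    using dual_convergence by metis
  have "(\<lambda>k. norm (y (Suc k) - y k) / \<rho>) \<longlonglongrightarrow> norm (ystar - ystar) / \<rho>"
    using rho by (intro tendsto_intros ystar LIMSEQ_Suc[OF ystar]) simp
  then show "(\<lambda>k. norm (y (Suc k) - y k) / \<rho>) \<longlonglongrightarrow> 0"
    by simp
  show "\<bar>norm (A (x (Suc k)) - b)\<bar> \<le> norm (y (Suc k) - y k) / \<rho>" if "k \<in> D" for k
  proof -
    have "1 \<le> k" using that by (simp add: descent_steps_def)
    then show ?thesis
      using residual[of k] descent[of k] that rho by (simp add: norm_minus_commute[of _ b])
  qed
qed (rule null(1))

text \<open>At a descent step, \<open>model_at_z\<close> expresses the objective through the model
  value; the error consists of the dual gap, the predicted decrease and a multiple of the residual,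
  collected in \<open>r\<close>.\<close>

lemma primal_value_limit:
  assumes inf: "infinite D" and min: "\<And>u. g ystar \<le> g u"
  shows "(\<lambda>k. c \<bullet> x k + g ystar) \<longlonglongrightarrow> 0"
proof (rule tendsto_piecewise_constant[where h = "\<lambda>u. c \<bullet> u + g ystar", OF inf])
  define r where
    "r k = \<bar>g (y k) - g ystar\<bar> + \<bar>descent_decr k\<bar> + norm (y (Suc k)) * norm (b - A (x (Suc k)))" for k
  obtain l where l: "y \<longlonglongrightarrow> l"
    using dual_convergence by metis
  have "descent_decr \<longlonglongrightarrow> 0"
    using summable_LIMSEQ_zero[OF summable_descent_decr] by (rule LIMSEQ_imp_Suc)
  then have "r \<longlonglongrightarrow> \<bar>g ystar - g ystar\<bar> + \<bar>0\<bar> + norm l * 0"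
    unfolding r_def using dual_value_limit[OF inf min] LIMSEQ_Suc[OF l]
      LIMSEQ_Suc[OF primal_residual_limit[OF inf], unfolded norm_minus_commute[of _ b]]
    by (intro tendsto_intros)
  then show "r \<longlonglongrightarrow> 0"
    by simp
  show "\<bar>c \<bullet> x (Suc k) + g ystar\<bar> \<le> r k" if k: "k \<in> D" for k
  proof -
    have k1: "1 \<le> k" using k by (simp add: descent_steps_def)
    have "c \<bullet> x (Suc k) + g ystar
        = descent_decr k - (g (y k) - g ystar) - y (Suc k) \<bullet> (b - A (x (Suc k)))"
      using model_at_z[OF k1] descent[OF k1 k] k
      by (simp add: lagr_def descent_decr_def pred_decrease_def)
    then show ?thesis
      unfolding r_def using Cauchy_Schwarz_ineq2[of "y (Suc k)" "b - A (x (Suc k))"] by linarith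
  qed
qed (rule null(1))

text \<open>Weak duality gives one inequality. The other needs a feasible point with objective
  \<open>- g ystar\<close>, which compactness extracts from the primal iterates.\<close>

lemma strong_duality:
  assumes inf: "infinite D" and min: "\<And>u. g ystar \<le> g u"
  shows "primal_opt_val A b c \<Omega> = - g ystar"
proof (rule antisym)
  have weak: "- g ystar \<le> c \<bullet> u" if "u \<in> \<Omega>" "A u = b" for u
    using dual_fun_ge[OF linear compact that(1), of b c ystar] that(2) by (simp add: lagr_def)
  \<comment> \<open>Only eventually: \<open>x 1\<close> is arbitrary and is copied until the first
    descent step.\<close>
  have "\<forall>\<^sub>F k in sequentially. x k \<in> \<Omega>"
  proof (rule eventually_piecewise_constant[where P = "\<lambda>u. u \<in> \<Omega>" and x = x, OF inf])
    show "x (Suc k) \<in> \<Omega>" if "k \<in> D" "1 \<le> k" for k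
      using descent(1)[of k] w_in[of k] model_set(1)[of k] that by auto
  qed (rule null(1))
  then obtain N where "\<And>k. x (k + N) \<in> \<Omega>"
    unfolding eventually_sequentially by (metis le_add2)
  then obtain l r where l\<Omega>: "l \<in> \<Omega>" and r: "strict_mono r" and l: "((\<lambda>k. x (k + N)) \<circ> r) \<longlonglongrightarrow> l"
    using compact[unfolded compact_def] by metis
  have "(\<lambda>k. A (x (r k + N))) \<longlonglongrightarrow> A l"
    using continuous_on_tendsto_compose[OF linear_continuous_on[of A UNIV] l] linear
    by (simp add: o_def linear_conv_bounded_linear)
  moreover have "(\<lambda>k. A (x (r k + N)) - b) \<longlonglongrightarrow> 0"
    using LIMSEQ_subseq_LIMSEQ[OF LIMSEQ_ignore_initial_segment[OF primal_residual_limit[OF inf]] r]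
    by (simp add: o_def tendsto_norm_zero_iff)
  ultimately have "A l = b"
    by (metis LIMSEQ_unique Lim_null)
  have "(\<lambda>k. c \<bullet> ((\<lambda>k. x (k + N)) \<circ> r) k + g ystar) \<longlonglongrightarrow> c \<bullet> l + g ystar"
    using l by (intro tendsto_intros)
  moreover have "(\<lambda>k. c \<bullet> ((\<lambda>k. x (k + N)) \<circ> r) k + g ystar) \<longlonglongrightarrow> 0"
    using LIMSEQ_subseq_LIMSEQ[OF LIMSEQ_ignore_initial_segment[OF primal_value_limit[OF inf min]] r]
    by (simp add: o_def)
  ultimately have "c \<bullet> l = - g ystar"
    using LIMSEQ_unique by fastforce
  moreover have "primal_opt_val A b c \<Omega> \<le> c \<bullet> l"
    unfolding primal_opt_val_def using weak l\<Omega> \<open>A l = b\<close>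
    by (intro cINF_lower bdd_belowI2[of _ "- g ystar"]) auto
  ultimately show "primal_opt_val A b c \<Omega> \<le> - g ystar"
    by simp
  show "- g ystar \<le> primal_opt_val A b c \<Omega>"
    unfolding primal_opt_val_def using weak l\<Omega> \<open>A l = b\<close>
    by (intro cINF_greatest) auto
qed

end

(* The primal limits need infinitely many descent steps: if y k hits a dual optimum exactly, all later
   steps can be null steps, which freeze x at a possibly infeasible point. *)
theorem theorem3:
  fixes A :: "real ^ 'n \<Rightarrow> real ^ 'm" and b :: "real ^ 'm" and c :: "real ^ 'n"
    and \<Omega> :: "(real ^ 'n) set" and \<rho> \<beta> :: real
    and \<Omega>s :: "nat \<Rightarrow> (real ^ 'n) set"
    and x w :: "nat \<Rightarrow> real ^ 'n" and y z :: "nat \<Rightarrow> real ^ 'm"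
  assumes "compact \<Omega>" and "convex \<Omega>"
    and "linear A"
    and "slater_primal A b \<Omega>" and "slater_dual A b c \<Omega>"
    and "\<rho> > 0" and "0 < \<beta>" and "\<beta> < 1"
    and "bala_run A b c \<Omega> \<rho> \<beta> \<Omega>s x y w z"
  shows "(\<exists>ystar. is_arg_min (dual_fun A b c \<Omega>) (\<lambda>_. True) ystar \<and> y \<longlonglongrightarrow> ystar) \<and>
    (infinite (descent_steps A b c \<Omega> \<beta> \<Omega>s y z) \<longrightarrow>
      (\<lambda>k. norm (A (x k) - b)) \<longlonglongrightarrow> 0 \<and>
      (\<lambda>k. c \<bullet> x k - primal_opt_val A b c \<Omega>) \<longlonglongrightarrow> 0)"
proof -
  interpret bala A b c \<Omega> \<rho> \<beta> \<Omega>s x w y z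
    using assms by (intro bala.intro)
  obtain ystar where min: "\<And>u. g ystar \<le> g u" and lim: "y \<longlonglongrightarrow> ystar"
    using dual_convergence by metis
  have "is_arg_min g (\<lambda>_. True) ystar"
    using min by (simp add: is_arg_min_linorder)
  moreover have "(\<lambda>k. c \<bullet> x k - primal_opt_val A b c \<Omega>) \<longlonglongrightarrow> 0" if "infinite D"
    using primal_value_limit[OF that min] strong_duality[OF that min] by simp
  ultimately show ?thesis
    using lim primal_residual_limit by blast
qed

end
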